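(* Let $\ell>2$ be an odd prime. For $a,N\in\mathbb F_\ell^*$, $$|H_a(N;\ell)|=\frac{\ell+\chi(aN)}{2}.$$ In particular, $|H_a(N;\ell)|$ equals $(\ell-1)/2$ or $(\ell+1)/2$, according as $aN$ is a quadratic nonresidue or quadratic residue modulo $\ell$.
   Context: $\chi$ denotes the Legendre symbol modulo $\ell$ on $\mathbb F_\ell$, with $\chi(0)=0$. $H_a(N;\ell)=\{ax+Nx^{-1}:x\in\mathbb F_\ell^*\}\subseteq\mathbb F_\ell$. *)

theory Defs
  imports Complex_Main "HOL-Number_Theory.Residues"
begin

text \<open>
  \<open>\<bbbF>\<^sub>l\<close> is rendered as \<^const>\<open>residue_ring\<close> \<open>l\<close>, whose carrier is \<open>{0..l - 1}\<close> (integers) and whose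
  operations are taken modulo \<open>l\<close>.
\<close>

definition H_set :: "int \<Rightarrow> int \<Rightarrow> nat \<Rightarrow> int set"
  where "H_set a N l =
    (let R = residue_ring (int l)
     in {a \<otimes>\<^bsub>R\<^esub> x \<oplus>\<^bsub>R\<^esub> N \<otimes>\<^bsub>R\<^esub> inv\<^bsub>R\<^esub> x | x. x \<in> Units R})"

end

theory Submission
  imports Defs
begin

text \<open>
  The value set is the image of the units under \<open>f x = a x + N / x\<close>, so it suffices to know the
  fibres of \<open>f\<close>. From
  \<open>x y (f x - f y) = (x - y) (a x y - N)\<close>,
  it follows that two units \<open>x\<close> and \<open>y\<close> have the same value exactly when \<open>y = x\<close> or \<open>y = N / (a x)\<close>
  (lemma \<open>hyperbola_fibre\<close>). Hence the fibres are the pairs \<open>{x, N / (a x)}\<close>; such a pair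
  collapses to a single point exactly when \<open>a x\<^sup>2 = N\<close>. Counting each such \<open>x\<close> a second time
  makes every fibre have weight 2 (lemma \<open>two_card_image_of_pairing\<close>), so twice the number of
  values is the number of units plus the number of solutions of \<open>a x\<^sup>2 = N\<close>.

  Since \<open>a x\<^sup>2 = N\<close> means \<open>(a x)\<^sup>2 = a N\<close>, the latter number is the number of square roots of
  \<open>a N\<close>, and this is \<open>1 + \<chi>(a N)\<close>: in odd characteristic the nonzero \<open>a N\<close> has two roots or none
  (lemma \<open>card_square_roots_eq_Legendre\<close>). The total is \<open>(l - 1) + (1 + \<chi>(a N)) = l + \<chi>(a N)\<close>.
  All steps before the count of square roots are valid in an arbitrary finite field.
\<close>

text \<open>
  Giving weight 2 to the fixed points of \<open>\<sigma>\<close> and weight 1 to all other points, each fibre of \<open>f\<close>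
  has total weight 2. The symmetry of \<open>f x = f y\<close> forces \<open>\<sigma>\<close> to be an involution, so that the
  fibres are its orbits.
\<close>

lemma two_card_image_of_pairing:
  assumes fin: "finite A"
    and closed: "\<And>x. x \<in> A \<Longrightarrow> \<sigma> x \<in> A"
    and fibre: "\<And>x y. x \<in> A \<Longrightarrow> y \<in> A \<Longrightarrow> f x = f y \<longleftrightarrow> y = x \<or> y = \<sigma> x"
  shows "2 * card (f ` A) = card A + card {x \<in> A. \<sigma> x = x}"
proof -
  let ?w = "\<lambda>x. 1 + of_bool (\<sigma> x = x) :: nat"
  have fibre_weight: "sum ?w {y \<in> A. f y = z} = 2" if "z \<in> f ` A" for z
  proof -
    from that obtain x where x: "x \<in> A" "z = f x" by blast
    have "{y \<in> A. f y = z} = {y \<in> A. y = x \<or> y = \<sigma> x}"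
      using x(2) fibre[OF x(1)] by (intro Collect_cong) metis
    also have "\<dots> = {x, \<sigma> x}"
      using x(1) closed by blast
    finally have eq: "{y \<in> A. f y = z} = {x, \<sigma> x}" .
    \<comment> \<open>The partner of a point that is not fixed is not fixed either: otherwise its fibre would be a
      singleton, although it contains \<open>x\<close>.\<close>
    have "\<sigma> (\<sigma> x) \<noteq> \<sigma> x" if "\<sigma> x \<noteq> x"
      using that x(1) closed[of x] fibre[of x "\<sigma> x"] fibre[of "\<sigma> x" x] by auto
    then show ?thesis unfolding eq by (cases "\<sigma> x = x") auto
  qed
  have "card A + card {x \<in> A. \<sigma> x = x} = sum ?w A"
    using fin by (simp add: sum_Suc Int_def)
  also have "\<dots> = (\<Sum>z\<in>f ` A. sum ?w {y \<in> A. f y = z})"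
    using fin by (rule sum.image_gen)
  also have "\<dots> = 2 * card (f ` A)"
    using fibre_weight by simp
  finally show ?thesis by simp
qed

text \<open>
  Clearing the denominators in \<open>f x - f y\<close> leaves a product with factors \<open>x - y\<close> and \<open>a x y - N\<close>,
  and a field has no zero divisors.
\<close>

lemma (in field) hyperbola_fibre:
  assumes a: "a \<in> Units R" and N: "N \<in> Units R" and x: "x \<in> Units R" and y: "y \<in> Units R"
  shows "a \<otimes> x \<oplus> N \<otimes> inv x = a \<otimes> y \<oplus> N \<otimes> inv y \<longleftrightarrow> y = x \<or> a \<otimes> x \<otimes> y = N"
    (is "?f x = ?f y \<longleftrightarrow> _")
proof -
  note carr [simp] = Units_closed[OF a] Units_closed[OF N] Units_closed[OF x] Units_closed[OF y]
    Units_inv_closed[OF x] Units_inv_closed[OF y]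
  have cl: "?f x \<in> carrier R" "?f y \<in> carrier R" by simp_all
  have "x \<otimes> y \<otimes> (?f x \<ominus> ?f y)
      = (a \<otimes> x \<otimes> x \<otimes> y \<oplus> N \<otimes> y \<otimes> (x \<otimes> inv x)) \<ominus> (a \<otimes> x \<otimes> y \<otimes> y \<oplus> N \<otimes> x \<otimes> (y \<otimes> inv y))"
    using carr by algebra
  moreover have "\<dots> = (a \<otimes> x \<otimes> x \<otimes> y \<oplus> N \<otimes> y) \<ominus> (a \<otimes> x \<otimes> y \<otimes> y \<oplus> N \<otimes> x)"
    using x y by simp
  moreover have "\<dots> = (x \<ominus> y) \<otimes> (a \<otimes> x \<otimes> y \<ominus> N)"
    using carr by algebra
  ultimately have key: "x \<otimes> y \<otimes> (?f x \<ominus> ?f y) = (x \<ominus> y) \<otimes> (a \<otimes> x \<otimes> y \<ominus> N)"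
    by simp
  have nz: "x \<otimes> y \<noteq> \<zero>"
    using Units_m_closed[OF x y] field_Units by auto
  have "?f x = ?f y \<longleftrightarrow> x \<otimes> y \<otimes> (?f x \<ominus> ?f y) = \<zero>"
    using nz cl by (simp add: integral_iff)
  also have "\<dots> \<longleftrightarrow> x = y \<or> a \<otimes> x \<otimes> y = N"
    unfolding key by (simp add: integral_iff)
  finally show ?thesis by auto
qed

text \<open>
  The points fixed by the pairing \<open>x \<mapsto> N / (a x)\<close> are counted by square roots of \<open>a N\<close>: multiplying
  \<open>a x\<^sup>2 = N\<close> by \<open>a\<close> turns it into \<open>(a x)\<^sup>2 = a N\<close>, so \<open>x \<mapsto> a x\<close> carries one set onto the other.
\<close>

lemma (in field) two_card_hyperbola_values:
  assumes fin: "finite (carrier R)" and a: "a \<in> Units R" and N: "N \<in> Units R"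
  shows "2 * card {a \<otimes> x \<oplus> N \<otimes> inv x | x. x \<in> Units R}
    = card (Units R) + card {y \<in> carrier R. y \<otimes> y = a \<otimes> N}"
proof -
  note [simp] = Units_closed[OF a] Units_closed[OF N]
  let ?f = "\<lambda>x. a \<otimes> x \<oplus> N \<otimes> inv x" and ?\<sigma> = "\<lambda>x. N \<otimes> inv (a \<otimes> x)"
  have partner: "y = ?\<sigma> x \<longleftrightarrow> a \<otimes> x \<otimes> y = N" if "x \<in> Units R" "y \<in> Units R" for x y
  proof -
    have u: "a \<otimes> x \<in> Units R" using a that(1) by simp
    show ?thesis
    proof
      assume "y = ?\<sigma> x"
      moreover have "a \<otimes> x \<otimes> (N \<otimes> inv (a \<otimes> x)) = N \<otimes> (a \<otimes> x \<otimes> inv (a \<otimes> x))"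
        using N u by (intro m_lcomm) (simp_all add: Units_closed)
      ultimately show "a \<otimes> x \<otimes> y = N" using u by simp
    next
      assume "a \<otimes> x \<otimes> y = N"
      moreover have "a \<otimes> x \<otimes> y \<otimes> inv (a \<otimes> x) = (a \<otimes> x \<otimes> inv (a \<otimes> x)) \<otimes> y"
        using u that(2) by (metis Units_closed Units_inv_closed m_assoc m_comm)
      ultimately show "y = ?\<sigma> x" using u that(2) by (simp add: Units_closed)
    qed
  qed
  have "2 * card (?f ` Units R) = card (Units R) + card {x \<in> Units R. ?\<sigma> x = x}"
  proof (rule two_card_image_of_pairing)
    show "finite (Units R)"
      using fin by (rule finite_ring_finite_units)
    show "?\<sigma> x \<in> Units R" if "x \<in> Units R" for x
      using that a N by simp
    show "?f x = ?f y \<longleftrightarrow> y = x \<or> y = ?\<sigma> x" if "x \<in> Units R" "y \<in> Units R" for x y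
      using hyperbola_fibre[OF a N that] partner[OF that] by simp
  qed
  moreover have "bij_betw (\<lambda>x. a \<otimes> x) {x \<in> Units R. ?\<sigma> x = x} {y \<in> carrier R. y \<otimes> y = a \<otimes> N}"
  proof (rule bij_betw_byWitness[where f' = "\<lambda>y. inv a \<otimes> y"])
    show "\<forall>x\<in>{x \<in> Units R. ?\<sigma> x = x}. inv a \<otimes> (a \<otimes> x) = x"
      using a by (auto simp: m_assoc[symmetric])
    show "\<forall>y\<in>{y \<in> carrier R. y \<otimes> y = a \<otimes> N}. a \<otimes> (inv a \<otimes> y) = y"
      using a by (auto simp: m_assoc[symmetric])
    show "(\<lambda>x. a \<otimes> x) ` {x \<in> Units R. ?\<sigma> x = x} \<subseteq> {y \<in> carrier R. y \<otimes> y = a \<otimes> N}"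
    proof clarify
      fix x assume x: "x \<in> Units R" "?\<sigma> x = x"
      then have "a \<otimes> x \<otimes> x = N" using partner[of x x] by simp
      moreover have "a \<otimes> x \<otimes> (a \<otimes> x) = a \<otimes> (a \<otimes> x \<otimes> x)"
        using x by (simp add: Units_closed m_ac)
      ultimately show "a \<otimes> x \<in> carrier R \<and> a \<otimes> x \<otimes> (a \<otimes> x) = a \<otimes> N"
        using x by (simp add: Units_closed)
    qed
    show "(\<lambda>y. inv a \<otimes> y) ` {y \<in> carrier R. y \<otimes> y = a \<otimes> N} \<subseteq> {x \<in> Units R. ?\<sigma> x = x}"
    proof clarify
      fix y assume y: "y \<in> carrier R" "y \<otimes> y = a \<otimes> N"
      have "y \<otimes> y \<noteq> \<zero>"
        using Units_m_closed[OF a N] unfolding y(2) field_Units by blast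
      then have "y \<in> Units R"
        using y(1) unfolding field_Units by auto
      then have u: "inv a \<otimes> y \<in> Units R" using a by simp
      have "a \<otimes> (inv a \<otimes> y) \<otimes> (inv a \<otimes> y) = y \<otimes> (inv a \<otimes> y)"
        using a y(1) by (simp add: m_assoc[symmetric])
      also have "\<dots> = inv a \<otimes> (y \<otimes> y)"
        using a y(1) by (intro m_lcomm) simp_all
      also have "\<dots> = N"
        using a y(2) by (simp add: m_assoc[symmetric])
      finally show "inv a \<otimes> y \<in> Units R \<and> ?\<sigma> (inv a \<otimes> y) = inv a \<otimes> y"
        using partner[OF u u] u by simp
    qed
  qed
  ultimately show ?thesis
    by (simp add: bij_betw_same_card Setcompr_eq_image)
qed

text \<open>
  A square root \<open>b\<close> of \<open>c\<close> gives exactly the roots \<open>b\<close> and \<open>- b\<close>. They are distinct: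
  \<open>b\<close> is nonzero because \<open>c\<close> is, so the odd prime \<open>p\<close> does not divide \<open>2 b\<close>.
\<close>

lemma (in residues_prime) card_square_roots_eq_Legendre:
  assumes "2 < p" and c: "c \<in> Units R"
  shows "int (card {y \<in> carrier R. y \<otimes> y = c}) = 1 + Legendre c (int p)"
proof -
  have crange: "0 < c" "c < int p"
    using c by (simp_all add: res_units_eq)
  then have "\<not> [c = 0] (mod int p)"
    by (simp add: cong_def)
  moreover have square: "y \<otimes> y = c \<longleftrightarrow> [y\<^sup>2 = c] (mod int p)" for y
    using crange by (simp add: res_mult_eq cong_def power2_eq_square)
  have QuadRes_iff: "QuadRes (int p) c \<longleftrightarrow> (\<exists>y\<in>carrier R. y \<otimes> y = c)"
  proof
    assume "QuadRes (int p) c"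
    then obtain y where "[y\<^sup>2 = c] (mod int p)" by (auto simp: QuadRes_def)
    then have "(y mod int p) \<otimes> (y mod int p) = c"
      by (simp add: square cong_def power_mod)
    then show "\<exists>y\<in>carrier R. y \<otimes> y = c" using mod_in_carrier by blast
  qed (auto simp: square QuadRes_def)
  moreover have "card {y \<in> carrier R. y \<otimes> y = c} = 2" if b: "b \<in> carrier R" "b \<otimes> b = c" for b
  proof -
    have "y \<otimes> y = c \<longleftrightarrow> y = b \<or> y = \<ominus> b" if y: "y \<in> carrier R" for y
    proof -
      have fac: "y \<otimes> y \<ominus> b \<otimes> b = (y \<ominus> b) \<otimes> (y \<ominus> \<ominus> b)"
        using y b(1) by algebra
      have "y \<otimes> y = c \<longleftrightarrow> y \<otimes> y \<ominus> b \<otimes> b = \<zero>"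
        using y b by auto
      then show ?thesis
        unfolding fac using y b(1) by (simp add: integral_iff)
    qed
    then have "{y \<in> carrier R. y \<otimes> y = c} = {b, \<ominus> b}"
      using b(1) by auto
    moreover have "b \<noteq> \<ominus> b"
    proof
      assume "b = \<ominus> b"
      then have "int p dvd 2 * b"
        by (metis add.right_inverse mod_0_imp_dvd mod_add_right_eq mult_2 res_neg_eq mod_0)
      moreover have "\<not> int p dvd 2"
        using \<open>2 < p\<close> by (auto dest: zdvd_imp_le)
      moreover have "\<not> int p dvd b"
        using b crange by (auto simp: res_mult_eq)
      ultimately show False
        using p_prime by (simp add: prime_dvd_mult_iff)
    qed
    ultimately show ?thesis by simp
  qed
  ultimately show ?thesis
    by (auto simp: Legendre_def)
qed

theorem lemma3p2:
  fixes l :: nat and a N :: int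
  assumes "prime l" and "l > 2"
    and "a \<in> Units (residue_ring (int l))"
    and "N \<in> Units (residue_ring (int l))"
  shows "real (card (H_set a N l)) =
      (real l + real_of_int (Legendre (a \<otimes>\<^bsub>residue_ring (int l)\<^esub> N) (int l))) / 2
    \<and> (\<not> QuadRes (int l) (a \<otimes>\<^bsub>residue_ring (int l)\<^esub> N) \<longrightarrow>
        real (card (H_set a N l)) = (real l - 1) / 2)
    \<and> (QuadRes (int l) (a \<otimes>\<^bsub>residue_ring (int l)\<^esub> N) \<longrightarrow>
        real (card (H_set a N l)) = (real l + 1) / 2)"
proof -
  define R where "R = residue_ring (int l)"
  interpret residues_prime l R
    using \<open>prime l\<close> by unfold_locales (simp_all add: R_def)
  have aN: "a \<in> Units R" "N \<in> Units R"
    using assms(3,4) by (simp_all add: R_def)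
  then have c: "a \<otimes>\<^bsub>R\<^esub> N \<in> Units R" by simp
  have "2 * card (H_set a N l) = card (Units R) + card {y \<in> carrier R. y \<otimes>\<^bsub>R\<^esub> y = a \<otimes>\<^bsub>R\<^esub> N}"
    using two_card_hyperbola_values[OF finite aN] by (simp add: H_set_def Let_def R_def)
  moreover have "int (card (Units R)) = int l - 1"
    using \<open>l > 2\<close> by (simp add: res_prime_units_eq)
  ultimately have "2 * int (card (H_set a N l)) = int l + Legendre (a \<otimes>\<^bsub>R\<^esub> N) (int l)"
    using card_square_roots_eq_Legendre[OF \<open>l > 2\<close> c] by linarith
  then have "2 * real (card (H_set a N l)) = real l + real_of_int (Legendre (a \<otimes>\<^bsub>R\<^esub> N) (int l))"
    by linarith
  moreover have "\<not> [a \<otimes>\<^bsub>R\<^esub> N = 0] (mod int l)"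
    using c by (simp add: res_units_eq cong_def)
  ultimately show ?thesis
    unfolding R_def[symmetric] by (auto simp: Legendre_def field_simps)
qed

end
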